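(* Let $(\Omega,\Gamma,\ell)$ be a game of prediction. For each $\alpha\in(-1,1)$ and each $\epsilon>0$, Sceptic has a strategy in the competitive prediction protocol that guarantees $$\frac{1-\alpha^2}{4}\sum_{n=1}^N\underline{D}^{[\alpha]}\left(\gamma^{[1]}_n\parallel\gamma^{[2]}_n\right)\le\frac{1-\alpha}{2}L^{[1]}_N+\frac{1+\alpha}{2}L^{[2]}_N-\tilde L_N+\epsilon$$ for all $N=1,2,\ldots$.
   Context: A game of prediction is a triple $(\Omega,\Gamma,\ell)$ where $\Omega$ (the outcome space) and $\Gamma$ (the prediction space) are arbitrary sets and $\ell:\Omega\times\Gamma\to\mathbb{R}$ is the loss function. As an exception, for log-loss games the loss function is also allowed to take the value $\infty$; in a log-loss game, $\Omega$ is a measurable space with a fixed $\sigma$-finite measure $\mu$, $\Gamma$ is the set of all measurable functions $\gamma:\Omega\to[0,\infty)$ with $\int\gamma\,d\mu=1$, and $\ell(\omega,\gamma)=-\ln\gamma(\omega)$, where $-\ln 0:=\infty$. Competitive prediction protocol (perfect information; players: Nature, Predictor 1, Predictor 2, Sceptic): at each step $n=1,2,\ldots$, first Predictor 1 and Predictor 2 announce $\gamma_n^{[1]}\in\Gamma$ and $\gamma_n^{[2]}\in\Gamma$; then Sceptic announces $\tilde\gamma_n\in\Gamma$; then Nature announces $\omega_n\in\Omega$. A strategy for Sceptic determines $\tilde\gamma_n$ from all moves made before it (including $\gamma_n^{[1]},\gamma_n^{[2]}$); it guarantees a property if the property holds whatever the moves of the other players when Sceptic follows it. Cumulative losses: $L_N^{[k]}:=\sum_{n=1}^N\ell(\omega_n,\gamma_n^{[k]})$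 for $k=1,2$, and $\tilde L_N:=\sum_{n=1}^N\ell(\omega_n,\tilde\gamma_n)$. A canonical prediction is a function $\lambda:\Omega\to\mathbb{R}$ for which there is $\gamma\in\Gamma$ with $\lambda(\omega)=\ell(\omega,\gamma)$ for all $\omega\in\Omega$ (the canonical prediction corresponding to $\gamma$). A superprediction is a function $\lambda:\Omega\to\mathbb{R}$ such that $\lambda\ge\lambda'$ pointwise for some canonical prediction $\lambda'$; the set of all superpredictions is denoted $\overline{\Lambda}$. For $\alpha\in(-1,1)$ and canonical predictions $\lambda_1,\lambda_2$, the lower $\alpha$-divergence between $\lambda_1$ and $\lambda_2$ is $$\underline{D}^{[\alpha]}(\lambda_1\parallel\lambda_2):=\frac{4}{1-\alpha^2}\sup\left\{t\in\mathbb{R}:\frac{1-\alpha}{2}\lambda_1+\frac{1+\alpha}{2}\lambda_2-t\in\overline{\Lambda}\right\},$$ which may take the values $-\infty$ or $\infty$. For $\gamma_1,\gamma_2\in\Gamma$, $\underline{D}^{[\alpha]}(\gamma_1\parallel\gamma_2)$ denotes $\underline{D}^{[\alpha]}(\lambda_1\parallel\lambda_2)$ for the canonical predictions $\lambda_1,\lambda_2$ corresponding to $\gamma_1,\gamma_2$.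
   Formalization: The inequality is claimed only for plays and N where, if some divergence among the first N is ∞, a Predictor's cumulative loss is ∞ too; otherwise it fails (one outcome, Γ=ℝ, loss ℓ(ω,γ)=γ: all divergences are ∞, right side real). Sceptic's loss is also shown to be finite. *)

theory Defs
  imports "HOL-Analysis.Analysis"
begin

text \<open>Functions on the outcome space \<open>\<Omega>\<close> are total functions on its type, and only their
  values on \<open>\<Omega>\<close> matter. Losses are extended reals so that log-loss may take the value
  \<open>\<infinity>\<close>; for every game admitted below they are never \<open>-\<infinity>\<close> on \<open>\<Omega> \<times> \<Gamma>\<close>.\<close>

definition densities :: "'o measure \<Rightarrow> ('o \<Rightarrow> real) set" where
  "densities \<mu> = {\<rho> \<in> borel_measurable \<mu>. \<rho> \<in> space \<mu> \<rightarrow>\<^sub>E {0..} \<and>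
                     (\<integral>\<^sup>+ \<omega>. ennreal (\<rho> \<omega>) \<partial>\<mu>) = 1}"

definition log_loss :: "'o \<Rightarrow> ('o \<Rightarrow> real) \<Rightarrow> ereal" where
  "log_loss \<omega> \<rho> = (if \<rho> \<omega> = 0 then \<infinity> else ereal (- ln (\<rho> \<omega>)))"

text \<open>Predictions have an arbitrary type here, so \<open>\<Gamma>\<close> is the set of all densities up to a
  bijection \<open>\<rho>\<close>; the identity gives the log-loss game itself.\<close>

definition log_loss_game :: "'o set \<Rightarrow> 'g set \<Rightarrow> ('o \<Rightarrow> 'g \<Rightarrow> ereal) \<Rightarrow> bool" where
  "log_loss_game \<Omega> \<Gamma> l \<longleftrightarrow>
     (\<exists>(\<mu> :: 'o measure) \<rho>. sigma_finite_measure \<mu> \<and> space \<mu> = \<Omega> \<and>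
        bij_betw \<rho> \<Gamma> (densities \<mu>) \<and> (\<forall>\<omega>\<in>\<Omega>. \<forall>\<gamma>\<in>\<Gamma>. l \<omega> \<gamma> = log_loss \<omega> (\<rho> \<gamma>)))"

definition prediction_game :: "'o set \<Rightarrow> 'g set \<Rightarrow> ('o \<Rightarrow> 'g \<Rightarrow> ereal) \<Rightarrow> bool" where
  "prediction_game \<Omega> \<Gamma> l \<longleftrightarrow>
     (\<forall>\<omega>\<in>\<Omega>. \<forall>\<gamma>\<in>\<Gamma>. \<bar>l \<omega> \<gamma>\<bar> \<noteq> \<infinity>) \<or> log_loss_game \<Omega> \<Gamma> l"

definition canonical :: "('o \<Rightarrow> 'g \<Rightarrow> ereal) \<Rightarrow> 'g \<Rightarrow> 'o \<Rightarrow> ereal" where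
  "canonical l \<gamma> = (\<lambda>\<omega>. l \<omega> \<gamma>)"

text \<open>For a real-valued loss the superpredictions proper are the real-valued members of this
  set. The extra members with value \<open>\<infinity>\<close> do not affect the divergence below, whose
  mixtures are then real-valued on \<open>\<Omega>\<close>.\<close>

definition superpredictions ::
    "'o set \<Rightarrow> 'g set \<Rightarrow> ('o \<Rightarrow> 'g \<Rightarrow> ereal) \<Rightarrow> ('o \<Rightarrow> ereal) set" where
  "superpredictions \<Omega> \<Gamma> l = {f. \<exists>\<gamma>\<in>\<Gamma>. \<forall>\<omega>\<in>\<Omega>. canonical l \<gamma> \<omega> \<le> f \<omega>}"

text \<open>The supremum is taken in the extended reals, so it is \<open>-\<infinity>\<close> for the empty set.\<close>

definition lower_divergence ::
    "'o set \<Rightarrow> 'g set \<Rightarrow> ('o \<Rightarrow> 'g \<Rightarrow> ereal) \<Rightarrow> real \<Rightarrow> ('o \<Rightarrow> ereal) \<Rightarrow> ('o \<Rightarrow> ereal) \<Rightarrow> ereal" where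
  "lower_divergence \<Omega> \<Gamma> l \<alpha> f1 f2 =
     ereal (4 / (1 - \<alpha>\<^sup>2)) *
     (SUP t \<in> {t :: real. (\<lambda>\<omega>. ereal ((1 - \<alpha>) / 2) * f1 \<omega> + ereal ((1 + \<alpha>) / 2) * f2 \<omega> - ereal t)
                            \<in> superpredictions \<Omega> \<Gamma> l}. ereal t)"

definition pred_divergence ::
    "'o set \<Rightarrow> 'g set \<Rightarrow> ('o \<Rightarrow> 'g \<Rightarrow> ereal) \<Rightarrow> real \<Rightarrow> 'g \<Rightarrow> 'g \<Rightarrow> ereal" where
  "pred_divergence \<Omega> \<Gamma> l \<alpha> \<gamma>1 \<gamma>2 =
     lower_divergence \<Omega> \<Gamma> l \<alpha> (canonical l \<gamma>1) (canonical l \<gamma>2)"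

definition cum_loss :: "('o \<Rightarrow> 'g \<Rightarrow> ereal) \<Rightarrow> (nat \<Rightarrow> 'g) \<Rightarrow> (nat \<Rightarrow> 'o) \<Rightarrow> nat \<Rightarrow> ereal" where
  "cum_loss l \<gamma> \<omega> N = (\<Sum>n = 1..N. l (\<omega> n) (\<gamma> n))"

text \<open>A round is recorded as (Predictor 1, Predictor 2, Sceptic, Nature). A strategy for Sceptic
  receives the list of completed rounds, oldest first, and the two current predictions.\<close>

type_synonym ('o, 'g) sceptic_strategy = "('g \<times> 'g \<times> 'g \<times> 'o) list \<Rightarrow> 'g \<Rightarrow> 'g \<Rightarrow> 'g"

definition legal_strategy :: "'o set \<Rightarrow> 'g set \<Rightarrow> ('o, 'g) sceptic_strategy \<Rightarrow> bool" where
  "legal_strategy \<Omega> \<Gamma> S \<longleftrightarrow>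
     (\<forall>h \<in> lists (\<Gamma> \<times> \<Gamma> \<times> \<Gamma> \<times> \<Omega>). \<forall>\<gamma>1\<in>\<Gamma>. \<forall>\<gamma>2\<in>\<Gamma>. S h \<gamma>1 \<gamma>2 \<in> \<Gamma>)"

text \<open>Rounds are numbered from 1; the values of the four sequences at 0 are irrelevant.\<close>

definition is_play ::
    "'o set \<Rightarrow> 'g set \<Rightarrow> ('o, 'g) sceptic_strategy \<Rightarrow>
     (nat \<Rightarrow> 'g) \<Rightarrow> (nat \<Rightarrow> 'g) \<Rightarrow> (nat \<Rightarrow> 'g) \<Rightarrow> (nat \<Rightarrow> 'o) \<Rightarrow> bool" where
  "is_play \<Omega> \<Gamma> S \<gamma>1 \<gamma>2 \<gamma>S \<omega> \<longleftrightarrow>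
     (\<forall>n\<ge>1. \<gamma>1 n \<in> \<Gamma> \<and> \<gamma>2 n \<in> \<Gamma> \<and> \<omega> n \<in> \<Omega> \<and>
        \<gamma>S n = S (map (\<lambda>i. (\<gamma>1 i, \<gamma>2 i, \<gamma>S i, \<omega> i)) [1..<n]) (\<gamma>1 n) (\<gamma>2 n))"

definition sceptic_can_guarantee ::
    "'o set \<Rightarrow> 'g set \<Rightarrow>
     ((nat \<Rightarrow> 'g) \<Rightarrow> (nat \<Rightarrow> 'g) \<Rightarrow> (nat \<Rightarrow> 'g) \<Rightarrow> (nat \<Rightarrow> 'o) \<Rightarrow> bool) \<Rightarrow> bool" where
  "sceptic_can_guarantee \<Omega> \<Gamma> P \<longleftrightarrow>
     (\<exists>S. legal_strategy \<Omega> \<Gamma> S \<and>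
        (\<forall>\<gamma>1 \<gamma>2 \<gamma>S \<omega>. is_play \<Omega> \<Gamma> S \<gamma>1 \<gamma>2 \<gamma>S \<omega> \<longrightarrow> P \<gamma>1 \<gamma>2 \<gamma>S \<omega>))"

end

theory Submission
  imports Defs
begin

text \<open>In every round Sceptic plays a prediction whose loss is within \<open>\<epsilon> / 2 ^ n\<close> of the
  best uniform lower shift of the mixture of the two predictors' losses, so that the errors
  add up to at most \<open>\<epsilon>\<close>. In a log-loss game a near-optimal density may vanish somewhere;
  mixing in a little of an everywhere positive density, which exists because \<open>\<mu>\<close> is
  \<open>\<sigma>\<close>-finite, keeps Sceptic's loss finite and raises it by arbitrarily little.\<close>

section \<open>Densities: an everywhere positive one, and mixtures\<close>

lemma densities_AE_nontrivial:
  assumes "g \<in> densities \<mu>"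
  shows "\<not> (AE x in \<mu>. False)"
proof
  assume "AE x in \<mu>. False"
  then have "AE x in \<mu>. ennreal (g x) = 0" by auto
  then have "(\<integral>\<^sup>+ x. ennreal (g x) \<partial>\<mu>) = (\<integral>\<^sup>+ x. 0 \<partial>\<mu>)"
    by (rule nn_integral_cong_AE)
  with assms show False by (simp add: densities_def)
qed

text \<open>On a \<sigma>-finite space some strictly positive function has a finite integral, so
  normalising it suffices. The density \<open>g\<close> is assumed only to rule out the zero
  measure, for which the normalising constant would be 0.\<close>

lemma positive_density_exists:
  assumes "sigma_finite_measure \<mu>" and "g \<in> densities \<mu>"
  obtains p where "p \<in> densities \<mu>" and "\<And>x. x \<in> space \<mu> \<Longrightarrow> 0 < p x"
proof -
  obtain h where h [measurable]: "h \<in> borel_measurable \<mu>"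
    and fin: "(\<integral>\<^sup>+ x. h x \<partial>\<mu>) \<noteq> \<infinity>"
    and pos: "\<And>x. x \<in> space \<mu> \<Longrightarrow> 0 < h x \<and> h x < \<infinity>"
    using sigma_finite_measure.Ex_finite_integrable_function[OF assms(1)] by blast
  define K where "K = enn2real (\<integral>\<^sup>+ x. h x \<partial>\<mu>)"
  \<comment> \<open>A positive function with integral 0 forces almost every point to satisfy
    \<open>False\<close>, contradicting the unit mass of \<open>g\<close>.\<close>
  have "(\<integral>\<^sup>+ x. h x \<partial>\<mu>) \<noteq> 0"
  proof
    assume "(\<integral>\<^sup>+ x. h x \<partial>\<mu>) = 0"
    then have "AE x in \<mu>. h x = 0" by (simp add: nn_integral_0_iff_AE)
    moreover have "AE x in \<mu>. h x \<noteq> 0"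
      using pos by (intro AE_I2) (metis less_irrefl)
    ultimately have "AE x in \<mu>. False" by eventually_elim contradiction
    with densities_AE_nontrivial[OF assms(2)] show False by contradiction
  qed
  with fin have K: "0 < K" and Kint: "(\<integral>\<^sup>+ x. h x \<partial>\<mu>) = ennreal K"
    by (auto simp: K_def enn2real_positive_iff top.not_eq_extremum zero_less_iff_neq_zero)
  \<comment> \<open>Members of \<open>densities\<close> are extensional, hence the restricted
    abstraction. Measurability and the integral see only the values on the space.\<close>
  define p where "p = (\<lambda>x\<in>space \<mu>. enn2real (h x) / K)"
  have ppos: "0 < p x" if "x \<in> space \<mu>" for x
    using pos[OF that] K that by (simp add: p_def enn2real_positive_iff)
  have "p \<in> borel_measurable \<mu> \<longleftrightarrow> (\<lambda>x. enn2real (h x) / K) \<in> borel_measurable \<mu>"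
    by (rule measurable_cong) (simp add: p_def)
  then have meas: "p \<in> borel_measurable \<mu>" by simp
  have "(\<integral>\<^sup>+ x. ennreal (p x) \<partial>\<mu>) = (\<integral>\<^sup>+ x. h x * ennreal (1 / K) \<partial>\<mu>)"
  proof (rule nn_integral_cong)
    fix x assume x: "x \<in> space \<mu>"
    then have "p x = enn2real (h x) * (1 / K)" by (simp add: p_def)
    then have "ennreal (p x) = ennreal (enn2real (h x)) * ennreal (1 / K)"
      using K by (simp only: ennreal_mult enn2real_nonneg zero_le_divide_1_iff less_imp_le)
    then show "ennreal (p x) = h x * ennreal (1 / K)"
      using pos[OF x] by simp
  qed
  also have "\<dots> = ennreal K * ennreal (1 / K)"
    by (simp only: nn_integral_multc[OF h] Kint)
  also have "\<dots> = ennreal (K * (1 / K))"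
    by (rule ennreal_mult[symmetric]) (use K in auto)
  also have "\<dots> = 1" using K by simp
  finally have "p \<in> densities \<mu>"
    using meas ppos by (auto simp: densities_def p_def less_imp_le)
  with ppos that show ?thesis by blast
qed

lemma densities_mix:
  assumes "f \<in> densities \<mu>" and "g \<in> densities \<mu>" and "0 \<le> c" and "c \<le> 1"
  shows "(\<lambda>x\<in>space \<mu>. c * f x + (1 - c) * g x) \<in> densities \<mu>" (is "?m \<in> _")
proof -
  have [measurable]: "f \<in> borel_measurable \<mu>" "g \<in> borel_measurable \<mu>"
    and nn: "\<And>x. x \<in> space \<mu> \<Longrightarrow> 0 \<le> f x" "\<And>x. x \<in> space \<mu> \<Longrightarrow> 0 \<le> g x"
    and int: "(\<integral>\<^sup>+ x. ennreal (f x) \<partial>\<mu>) = 1" "(\<integral>\<^sup>+ x. ennreal (g x) \<partial>\<mu>) = 1"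
    using assms(1,2) by (auto simp: densities_def PiE_iff)
  have "?m \<in> borel_measurable \<mu> \<longleftrightarrow> (\<lambda>x. c * f x + (1 - c) * g x) \<in> borel_measurable \<mu>"
    by (rule measurable_cong) simp
  then have meas: "?m \<in> borel_measurable \<mu>" by simp
  have "(\<integral>\<^sup>+ x. ennreal (?m x) \<partial>\<mu>)
      = (\<integral>\<^sup>+ x. ennreal c * ennreal (f x) + ennreal (1 - c) * ennreal (g x) \<partial>\<mu>)"
    by (rule nn_integral_cong) (use nn assms in \<open>simp add: ennreal_mult ennreal_plus\<close>)
  also have "\<dots> = ennreal c + ennreal (1 - c)"
    by (simp add: nn_integral_add nn_integral_cmult int)
  also have "\<dots> = 1" using assms by (simp flip: ennreal_plus)
  finally show ?thesis
    using meas nn assms by (auto simp: densities_def)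
qed

text \<open>Only log-loss needs an argument. Scaling a density by \<open>exp (- \<delta>)\<close>
  raises its log-loss by exactly \<delta>; the freed mass goes to an everywhere positive density,
  which makes the loss finite at every outcome and can only lower it further.\<close>

lemma loss_smoothing:
  fixes l :: "'o \<Rightarrow> 'g \<Rightarrow> ereal"
  assumes game: "prediction_game \<Omega> \<Gamma> l" and g: "\<gamma> \<in> \<Gamma>" and d: "0 < \<delta>"
  obtains \<gamma>' where "\<gamma>' \<in> \<Gamma>"
    and "\<And>\<omega>. \<omega> \<in> \<Omega> \<Longrightarrow> l \<omega> \<gamma>' \<noteq> \<infinity> \<and> l \<omega> \<gamma>' \<le> l \<omega> \<gamma> + ereal \<delta>"
  using game unfolding prediction_game_def
proof (elim disjE)
  assume real: "\<forall>\<omega>\<in>\<Omega>. \<forall>\<gamma>\<in>\<Gamma>. \<bar>l \<omega> \<gamma>\<bar> \<noteq> \<infinity>"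
  show ?thesis
  proof (rule that[OF g])
    fix \<omega> assume "\<omega> \<in> \<Omega>"
    with real g have "\<bar>l \<omega> \<gamma>\<bar> \<noteq> \<infinity>" by simp
    with d show "l \<omega> \<gamma> \<noteq> \<infinity> \<and> l \<omega> \<gamma> \<le> l \<omega> \<gamma> + ereal \<delta>" by (cases "l \<omega> \<gamma>") auto
  qed
next
  assume "log_loss_game \<Omega> \<Gamma> l"
  then obtain \<mu> :: "'o measure" and \<rho> where sf: "sigma_finite_measure \<mu>" and sp: "space \<mu> = \<Omega>"
    and bij: "bij_betw \<rho> \<Gamma> (densities \<mu>)"
    and l: "\<And>\<omega> \<gamma>. \<omega> \<in> \<Omega> \<Longrightarrow> \<gamma> \<in> \<Gamma> \<Longrightarrow> l \<omega> \<gamma> = log_loss \<omega> (\<rho> \<gamma>)"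
    unfolding log_loss_game_def by blast
  have dens: "\<rho> \<gamma> \<in> densities \<mu>" using bij g by (auto simp: bij_betw_def)
  obtain p where p: "p \<in> densities \<mu>" and pp: "\<And>x. x \<in> space \<mu> \<Longrightarrow> 0 < p x"
    by (rule positive_density_exists[OF sf dens]) blast
  define c where "c = exp (- \<delta>)"
  have c: "0 < c" "c < 1" using d by (auto simp: c_def)
  define m where "m = (\<lambda>x\<in>space \<mu>. c * \<rho> \<gamma> x + (1 - c) * p x)"
  have "m \<in> densities \<mu>" unfolding m_def using dens p c by (intro densities_mix) auto
  then obtain \<gamma>' where g': "\<gamma>' \<in> \<Gamma>" "\<rho> \<gamma>' = m"
    using bij by (metis bij_betw_imp_surj_on imageE)
  show ?thesis
  proof (rule that[OF g'(1)])
    fix \<omega> assume w: "\<omega> \<in> \<Omega>"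
    have nn: "0 \<le> \<rho> \<gamma> \<omega>" using dens w sp by (auto simp: densities_def PiE_iff)
    have m: "m \<omega> = c * \<rho> \<gamma> \<omega> + (1 - c) * p \<omega>" using w sp by (simp add: m_def)
    have q: "0 < (1 - c) * p \<omega>" using c pp w sp by simp
    have mpos: "0 < m \<omega>" unfolding m using nn c q by (simp add: add_nonneg_pos)
    \<comment> \<open>Where the old density vanishes, the old loss is \<infinity> and the upper
      bound is trivial; elsewhere \<open>m\<close> dominates
      \<open>c * \<rho> \<gamma>\<close>.\<close>
    have "- ln (m \<omega>) \<le> - ln (\<rho> \<gamma> \<omega>) + \<delta>" if "\<rho> \<gamma> \<omega> \<noteq> 0"
    proof -
      have "ln (c * \<rho> \<gamma> \<omega>) \<le> ln (m \<omega>)"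
        using that nn c q mpos m by (intro ln_mono) auto
      moreover have "ln (c * \<rho> \<gamma> \<omega>) = - \<delta> + ln (\<rho> \<gamma> \<omega>)"
        using that nn c by (subst ln_mult_pos) (auto simp: c_def)
      ultimately show ?thesis by simp
    qed
    with mpos show "l \<omega> \<gamma>' \<noteq> \<infinity> \<and> l \<omega> \<gamma>' \<le> l \<omega> \<gamma> + ereal \<delta>"
      using w g g' by (auto simp: l log_loss_def)
  qed
qed

section \<open>Sceptic's move in a single round\<close>

lemma prediction_game_loss_not_MInfty:
  assumes "prediction_game \<Omega> \<Gamma> l" and "\<omega> \<in> \<Omega>" and "\<gamma> \<in> \<Gamma>"
  shows "l \<omega> \<gamma> \<noteq> -\<infinity>"
  using assms(1) unfolding prediction_game_def
proof
  assume "\<forall>\<omega>\<in>\<Omega>. \<forall>\<gamma>\<in>\<Gamma>. \<bar>l \<omega> \<gamma>\<bar> \<noteq> \<infinity>"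
  with assms(2,3) have "\<bar>l \<omega> \<gamma>\<bar> \<noteq> \<infinity>" by simp
  then show ?thesis by auto
next
  assume "log_loss_game \<Omega> \<Gamma> l"
  then obtain \<rho> where "l \<omega> \<gamma> = log_loss \<omega> (\<rho> \<gamma>)"
    using assms(2,3) unfolding log_loss_game_def by blast
  then show ?thesis by (simp add: log_loss_def)
qed

text \<open>The one-round inequality, solved for the divergence and stated over the reals. The
  guards matter because \<open>real_of_ereal\<close> sends infinite values to 0, and because no real
  bound can hold for an infinite divergence. Finiteness of Sceptic's own loss is demanded in every
  case, so that it never spoils a later difference.\<close>

definition sceptic_move_ok ::
    "'o set \<Rightarrow> 'g set \<Rightarrow> ('o \<Rightarrow> 'g \<Rightarrow> ereal) \<Rightarrow> real \<Rightarrow> real \<Rightarrow> 'g \<Rightarrow> 'g \<Rightarrow> 'g \<Rightarrow> bool" where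
  "sceptic_move_ok \<Omega> \<Gamma> l \<alpha> \<delta> \<gamma>1 \<gamma>2 \<gamma> \<longleftrightarrow> \<gamma> \<in> \<Gamma> \<and>
     (\<forall>\<omega>\<in>\<Omega>. l \<omega> \<gamma> \<noteq> \<infinity> \<and>
       (pred_divergence \<Omega> \<Gamma> l \<alpha> \<gamma>1 \<gamma>2 \<noteq> \<infinity> \<longrightarrow> \<bar>l \<omega> \<gamma>1\<bar> \<noteq> \<infinity> \<longrightarrow> \<bar>l \<omega> \<gamma>2\<bar> \<noteq> \<infinity> \<longrightarrow>
         pred_divergence \<Omega> \<Gamma> l \<alpha> \<gamma>1 \<gamma>2
           \<le> ereal (4 / (1 - \<alpha>\<^sup>2) * ((1 - \<alpha>) / 2 * real_of_ereal (l \<omega> \<gamma>1)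
               + (1 + \<alpha>) / 2 * real_of_ereal (l \<omega> \<gamma>2) - real_of_ereal (l \<omega> \<gamma>) + \<delta>))))"

text \<open>The tolerance is split in half: one \<delta>/2 pays for a shift \<open>t\<close> that
  falls short of the supremum \<open>s\<close>, the other for smoothing the prediction that
  witnesses \<open>t\<close>. The supremum itself need not be attained.\<close>

lemma sceptic_move_exists:
  fixes l :: "'o \<Rightarrow> 'g \<Rightarrow> ereal"
  assumes game: "prediction_game \<Omega> \<Gamma> l" and a: "-1 < \<alpha>" "\<alpha> < 1" and d: "0 < \<delta>"
    and g1: "\<gamma>1 \<in> \<Gamma>" and g2: "\<gamma>2 \<in> \<Gamma>"
  shows "\<exists>\<gamma>. sceptic_move_ok \<Omega> \<Gamma> l \<alpha> \<delta> \<gamma>1 \<gamma>2 \<gamma>"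
proof -
  define T where "T = {t :: real. (\<lambda>\<omega>. ereal ((1 - \<alpha>) / 2) * l \<omega> \<gamma>1
      + ereal ((1 + \<alpha>) / 2) * l \<omega> \<gamma>2 - ereal t) \<in> superpredictions \<Omega> \<Gamma> l}"
  define s where "s = (SUP t\<in>T. ereal t)"
  have "\<alpha>\<^sup>2 < 1" using a by (simp add: abs_square_less_1)
  then have c: "0 < 4 / (1 - \<alpha>\<^sup>2)" by simp
  have D: "pred_divergence \<Omega> \<Gamma> l \<alpha> \<gamma>1 \<gamma>2 = ereal (4 / (1 - \<alpha>\<^sup>2)) * s"
    by (simp add: pred_divergence_def lower_divergence_def canonical_def s_def T_def)
  \<comment> \<open>Smoothing Predictor 1's move gives some prediction of finite loss. This is all
    that is required when \<open>s\<close> is infinite: for \<infinity> the bound is guarded away,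
    for -\<infinity> it is trivial.\<close>
  obtain \<gamma>' where fallback: "\<gamma>' \<in> \<Gamma>" "\<And>\<omega>. \<omega> \<in> \<Omega> \<Longrightarrow> l \<omega> \<gamma>' \<noteq> \<infinity>"
    by (rule loss_smoothing[OF game g1 d]) blast
  show ?thesis
  proof (cases s)
    case (real r)
    have "s - ereal (\<delta> / 2) < (SUP t\<in>T. ereal t)"
      using real d by (simp flip: s_def)
    then obtain t where t: "t \<in> T" "r - \<delta> / 2 < t"
      using real by (auto simp: less_SUP_iff)
    then obtain \<gamma>0 where g0: "\<gamma>0 \<in> \<Gamma>"
      and le: "\<And>\<omega>. \<omega> \<in> \<Omega> \<Longrightarrow> l \<omega> \<gamma>0 \<le> ereal ((1 - \<alpha>) / 2) * l \<omega> \<gamma>1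
        + ereal ((1 + \<alpha>) / 2) * l \<omega> \<gamma>2 - ereal t"
      by (auto simp: T_def superpredictions_def canonical_def)
    from d have "0 < \<delta> / 2" by simp
    from loss_smoothing[OF game g0 this] obtain \<gamma> where g: "\<gamma> \<in> \<Gamma>"
      and sm: "\<And>\<omega>. \<omega> \<in> \<Omega> \<Longrightarrow> l \<omega> \<gamma> \<noteq> \<infinity> \<and> l \<omega> \<gamma> \<le> l \<omega> \<gamma>0 + ereal (\<delta> / 2)"
      by blast
    have "pred_divergence \<Omega> \<Gamma> l \<alpha> \<gamma>1 \<gamma>2
           \<le> ereal (4 / (1 - \<alpha>\<^sup>2) * ((1 - \<alpha>) / 2 * real_of_ereal (l \<omega> \<gamma>1)
               + (1 + \<alpha>) / 2 * real_of_ereal (l \<omega> \<gamma>2) - real_of_ereal (l \<omega> \<gamma>) + \<delta>))"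
      if w: "\<omega> \<in> \<Omega>" and fin: "\<bar>l \<omega> \<gamma>1\<bar> \<noteq> \<infinity>" "\<bar>l \<omega> \<gamma>2\<bar> \<noteq> \<infinity>" for \<omega>
    proof -
      obtain x y where xy: "l \<omega> \<gamma>1 = ereal x" "l \<omega> \<gamma>2 = ereal y" using fin by auto
      obtain z where z: "l \<omega> \<gamma> = ereal z"
        using sm[OF w] prediction_game_loss_not_MInfty[OF game w g] by (cases "l \<omega> \<gamma>") auto
      \<comment> \<open>Both predictors' losses are finite at this outcome, so the shifted mixture
        above \<open>l \<omega> \<gamma>0\<close> is finite too.\<close>
      obtain z0 where z0: "l \<omega> \<gamma>0 = ereal z0"
        using le[OF w] prediction_game_loss_not_MInfty[OF game w g0] xy
        by (cases "l \<omega> \<gamma>0") auto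
      \<comment> \<open>Chain of \<open>r < t + \<delta> / 2\<close>,
        \<open>t \<le> mixture - z0\<close> and \<open>z \<le> z0 + \<delta> / 2\<close>.\<close>
      have "r \<le> (1 - \<alpha>) / 2 * x + (1 + \<alpha>) / 2 * y - z + \<delta>"
        using le[OF w] sm[OF w] t(2) by (simp add: xy z z0)
      with c show ?thesis
        by (simp only: D real xy z times_ereal.simps ereal_less_eq real_of_ereal.simps)
          (rule mult_left_mono, auto)
    qed
    with g sm have "sceptic_move_ok \<Omega> \<Gamma> l \<alpha> \<delta> \<gamma>1 \<gamma>2 \<gamma>"
      unfolding sceptic_move_ok_def by simp
    then show ?thesis ..
  next
    case PInf
    with c have "pred_divergence \<Omega> \<Gamma> l \<alpha> \<gamma>1 \<gamma>2 = \<infinity>" by (simp add: D)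
    with fallback show ?thesis by (auto simp: sceptic_move_ok_def)
  next
    case MInf
    with c have "pred_divergence \<Omega> \<Gamma> l \<alpha> \<gamma>1 \<gamma>2 = -\<infinity>" by (simp add: D)
    with fallback show ?thesis by (auto simp: sceptic_move_ok_def)
  qed
qed

section \<open>Accumulated error and cumulative losses\<close>

lemma sum_halves_le: "(\<Sum>n = 1..N. \<epsilon> / 2 ^ n) \<le> (\<epsilon> :: real)" if "0 \<le> \<epsilon>"
proof -
  \<comment> \<open>The exact value is proved because the bound \<epsilon> alone leaves no room for
    the next term in an induction.\<close>
  have "(\<Sum>n = 1..N. \<epsilon> / 2 ^ n) = \<epsilon> - \<epsilon> / 2 ^ N"
    by (induction N) (auto simp: field_simps)
  with that show ?thesis by simp
qed

lemma cum_loss_not_MInfty: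
  assumes "\<And>n. n \<in> {1..N} \<Longrightarrow> l (\<omega> n) (\<gamma> n) \<noteq> -\<infinity>"
  shows "cum_loss l \<gamma> \<omega> N \<noteq> -\<infinity>"
proof -
  \<comment> \<open>Stated for all subsets of the index range so that induction on finite sets keeps
    the assumption on each term available.\<close>
  have "(\<Sum>n\<in>A. l (\<omega> n) (\<gamma> n)) \<noteq> -\<infinity>" if "finite A" "A \<subseteq> {1..N}" for A
    using that
  proof (induction A rule: finite_induct)
    case (insert n A)
    then have "l (\<omega> n) (\<gamma> n) \<noteq> -\<infinity>" by (intro assms) simp
    with insert show ?case by simp
  qed simp
  from this[of "{1..N}"] show ?thesis by (simp add: cum_loss_def)
qed

lemma cum_loss_PInfty_iff:
  "cum_loss l \<gamma> \<omega> N = \<infinity> \<longleftrightarrow> (\<exists>n\<in>{1..N}. l (\<omega> n) (\<gamma> n) = \<infinity>)"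
  by (auto simp: cum_loss_def sum_Pinfty)

lemma cum_loss_real:
  assumes "\<And>n. n \<in> {1..N} \<Longrightarrow> \<bar>l (\<omega> n) (\<gamma> n)\<bar> \<noteq> \<infinity>"
  shows "cum_loss l \<gamma> \<omega> N = ereal (\<Sum>n = 1..N. real_of_ereal (l (\<omega> n) (\<gamma> n)))"
proof -
  have "cum_loss l \<gamma> \<omega> N = (\<Sum>n = 1..N. ereal (real_of_ereal (l (\<omega> n) (\<gamma> n))))"
    unfolding cum_loss_def by (rule sum.cong) (use assms in \<open>auto simp: ereal_real\<close>)
  then show ?thesis by simp
qed

text \<open>A divergence can be \<infinity> while all losses are finite, for instance if \<Gamma> is
  the set of reals and \<open>l \<omega> \<gamma> = \<gamma>\<close>; the left side is then
  \<infinity> and the right side real. The inner premise confines the claim to those N for which an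
  infinite divergence comes with an infinite cumulative loss of a predictor. Finiteness of Sceptic's
  loss is asserted along with the inequality because \<open>ereal\<close> evaluates \<infinity> -
  \<infinity> to \<infinity>, which would make the inequality hold for the wrong reason.\<close>

theorem proposition6:
  fixes \<Omega> :: "'o set" and \<Gamma> :: "'g set" and l :: "'o \<Rightarrow> 'g \<Rightarrow> ereal" and \<alpha> \<epsilon> :: real
  assumes "prediction_game \<Omega> \<Gamma> l" and "-1 < \<alpha>" and "\<alpha> < 1" and "0 < \<epsilon>"
  shows "sceptic_can_guarantee \<Omega> \<Gamma> (\<lambda>\<gamma>1 \<gamma>2 \<gamma>S \<omega>. \<forall>N\<ge>1.
           ((\<exists>n\<in>{1..N}. pred_divergence \<Omega> \<Gamma> l \<alpha> (\<gamma>1 n) (\<gamma>2 n) = \<infinity>) \<longrightarrow>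
              cum_loss l \<gamma>1 \<omega> N = \<infinity> \<or> cum_loss l \<gamma>2 \<omega> N = \<infinity>) \<longrightarrow>
           cum_loss l \<gamma>S \<omega> N \<noteq> \<infinity> \<and>
           ereal ((1 - \<alpha>\<^sup>2) / 4) * (\<Sum>n = 1..N. pred_divergence \<Omega> \<Gamma> l \<alpha> (\<gamma>1 n) (\<gamma>2 n))
             \<le> ereal ((1 - \<alpha>) / 2) * cum_loss l \<gamma>1 \<omega> N
               + ereal ((1 + \<alpha>) / 2) * cum_loss l \<gamma>2 \<omega> N
               - cum_loss l \<gamma>S \<omega> N + ereal \<epsilon>)"
proof -
  note game = assms(1)
  define \<delta> where "\<delta> n = \<epsilon> / 2 ^ n" for n :: nat
  have \<delta>: "0 < \<delta> n" for n using assms(4) by (simp add: \<delta>_def)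
  \<comment> \<open>\<open>h\<close> holds the completed rounds, so the current round has number
    \<open>Suc (length h)\<close>. The history enters only through this number, which fixes the
    tolerance.\<close>
  define S where "S h \<gamma>1 \<gamma>2 = (SOME \<gamma>. sceptic_move_ok \<Omega> \<Gamma> l \<alpha> (\<delta> (Suc (length h))) \<gamma>1 \<gamma>2 \<gamma>)"
    for h :: "('g \<times> 'g \<times> 'g \<times> 'o) list" and \<gamma>1 \<gamma>2
  have S: "sceptic_move_ok \<Omega> \<Gamma> l \<alpha> (\<delta> (Suc (length h))) \<gamma>1 \<gamma>2 (S h \<gamma>1 \<gamma>2)"
    if "\<gamma>1 \<in> \<Gamma>" "\<gamma>2 \<in> \<Gamma>" for h \<gamma>1 \<gamma>2
    unfolding S_def by (rule someI_ex, rule sceptic_move_exists[OF game assms(2,3) \<delta> that])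
  have legal: "legal_strategy \<Omega> \<Gamma> S"
    using S by (auto simp: legal_strategy_def sceptic_move_ok_def)
  have "cum_loss l \<gamma>S \<omega> N \<noteq> \<infinity> \<and>
      ereal ((1 - \<alpha>\<^sup>2) / 4) * (\<Sum>n = 1..N. pred_divergence \<Omega> \<Gamma> l \<alpha> (\<gamma>1 n) (\<gamma>2 n))
        \<le> ereal ((1 - \<alpha>) / 2) * cum_loss l \<gamma>1 \<omega> N + ereal ((1 + \<alpha>) / 2) * cum_loss l \<gamma>2 \<omega> N
          - cum_loss l \<gamma>S \<omega> N + ereal \<epsilon>"
    if play: "is_play \<Omega> \<Gamma> S \<gamma>1 \<gamma>2 \<gamma>S \<omega>"
      and inf: "(\<exists>n\<in>{1..N}. pred_divergence \<Omega> \<Gamma> l \<alpha> (\<gamma>1 n) (\<gamma>2 n) = \<infinity>) \<longrightarrow>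
              cum_loss l \<gamma>1 \<omega> N = \<infinity> \<or> cum_loss l \<gamma>2 \<omega> N = \<infinity>"
    for \<gamma>1 \<gamma>2 \<gamma>S \<omega> N
  proof -
    let ?D = "\<lambda>n. pred_divergence \<Omega> \<Gamma> l \<alpha> (\<gamma>1 n) (\<gamma>2 n)"
    have mem: "\<gamma>1 n \<in> \<Gamma>" "\<gamma>2 n \<in> \<Gamma>" "\<omega> n \<in> \<Omega>" if "n \<in> {1..N}" for n
      using play that by (auto simp: is_play_def)
    have ok: "sceptic_move_ok \<Omega> \<Gamma> l \<alpha> (\<delta> n) (\<gamma>1 n) (\<gamma>2 n) (\<gamma>S n)" if n: "n \<in> {1..N}" for n
    proof -
      define h where "h = map (\<lambda>i. (\<gamma>1 i, \<gamma>2 i, \<gamma>S i, \<omega> i)) [1..<n]"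
      have "\<gamma>S n = S h (\<gamma>1 n) (\<gamma>2 n)" using play n by (auto simp: is_play_def h_def)
      moreover have "Suc (length h) = n" using n by (simp add: h_def)
      ultimately show ?thesis using S[OF mem(1,2)[OF n], of h] by simp
    qed
    have memS: "\<gamma>S n \<in> \<Gamma>" if "n \<in> {1..N}" for n
      using ok[OF that] by (simp add: sceptic_move_ok_def)
    note nMInf = prediction_game_loss_not_MInfty[OF game]
    have finS: "\<bar>l (\<omega> n) (\<gamma>S n)\<bar> \<noteq> \<infinity>" if "n \<in> {1..N}" for n
      using ok[OF that] mem(3)[OF that] nMInf[OF mem(3)[OF that] memS[OF that]]
      by (auto simp: sceptic_move_ok_def)
    \<comment> \<open>Sceptic's cumulative loss is real whatever the predictors do, which settles
      the first conjunct in both cases below.\<close>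
    have LS: "cum_loss l \<gamma>S \<omega> N = ereal (\<Sum>n = 1..N. real_of_ereal (l (\<omega> n) (\<gamma>S n)))"
      by (rule cum_loss_real, rule finS)
    have nM: "cum_loss l \<gamma>1 \<omega> N \<noteq> -\<infinity>" "cum_loss l \<gamma>2 \<omega> N \<noteq> -\<infinity>"
      by (rule cum_loss_not_MInfty, rule nMInf, erule mem, erule mem)+
    have ab: "0 < (1 - \<alpha>) / 2" "0 < (1 + \<alpha>) / 2" using assms by auto
    have "\<alpha>\<^sup>2 < 1" using assms(2,3) by (simp add: abs_square_less_1)
    then have c: "0 < (1 - \<alpha>\<^sup>2) / 4" by simp
    show ?thesis
    \<comment> \<open>If a predictor's cumulative loss is infinite, so is the right side, and the
      left side may be anything. Otherwise the premise excludes infinite divergences, and the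
      one-round bounds can be added.\<close>
    proof (cases "cum_loss l \<gamma>1 \<omega> N = \<infinity> \<or> cum_loss l \<gamma>2 \<omega> N = \<infinity>")
      case True
      then have mix: "ereal ((1 - \<alpha>) / 2) * cum_loss l \<gamma>1 \<omega> N
          + ereal ((1 + \<alpha>) / 2) * cum_loss l \<gamma>2 \<omega> N = \<infinity>"
        using nM ab by (cases "cum_loss l \<gamma>1 \<omega> N"; cases "cum_loss l \<gamma>2 \<omega> N") auto
      show ?thesis unfolding mix LS by simp
    next
      case False
      with inf have Dfin: "?D n \<noteq> \<infinity>" if "n \<in> {1..N}" for n using that by metis
      \<comment> \<open>With no term equal to -\<infinity>, a cumulative loss other than \<infinity>
        forces every term to be real.\<close>
      have fin1: "\<bar>l (\<omega> n) (\<gamma>1 n)\<bar> \<noteq> \<infinity>" and fin2: "\<bar>l (\<omega> n) (\<gamma>2 n)\<bar> \<noteq> \<infinity>"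
        if "n \<in> {1..N}" for n
        using that False nMInf[OF mem(3)[OF that] mem(1)[OF that]]
          nMInf[OF mem(3)[OF that] mem(2)[OF that]]
        by (auto simp: cum_loss_PInfty_iff)
      have L1: "cum_loss l \<gamma>1 \<omega> N = ereal (\<Sum>n = 1..N. real_of_ereal (l (\<omega> n) (\<gamma>1 n)))"
      by (rule cum_loss_real, rule fin1)
      have L2: "cum_loss l \<gamma>2 \<omega> N = ereal (\<Sum>n = 1..N. real_of_ereal (l (\<omega> n) (\<gamma>2 n)))"
      by (rule cum_loss_real, rule fin2)
      let ?x = "\<lambda>n. real_of_ereal (l (\<omega> n) (\<gamma>1 n))"
      let ?y = "\<lambda>n. real_of_ereal (l (\<omega> n) (\<gamma>2 n))"
      let ?z = "\<lambda>n. real_of_ereal (l (\<omega> n) (\<gamma>S n))"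
      let ?R = "\<lambda>n. (1 - \<alpha>) / 2 * ?x n + (1 + \<alpha>) / 2 * ?y n - ?z n + \<delta> n"
      \<comment> \<open>A divergence may still be -\<infinity>, so the left side stays in
        \<open>ereal\<close>; only the bounds are real.\<close>
      have "(\<Sum>n = 1..N. ?D n) \<le> (\<Sum>n = 1..N. ereal (4 / (1 - \<alpha>\<^sup>2) * ?R n))"
      proof (rule sum_mono)
        fix n assume n: "n \<in> {1..N}"
        show "?D n \<le> ereal (4 / (1 - \<alpha>\<^sup>2) * ?R n)"
          using ok[OF n] Dfin[OF n] fin1[OF n] fin2[OF n] mem(3)[OF n]
          unfolding sceptic_move_ok_def by simp
      qed
      also have "\<dots> = ereal (4 / (1 - \<alpha>\<^sup>2) * (\<Sum>n = 1..N. ?R n))"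
        by (simp only: sum_ereal sum_distrib_left)
      \<comment> \<open>The positive factor cancels the 4 / (1 - \<alpha>^2) built into the
        divergence.\<close>
      finally have "ereal ((1 - \<alpha>\<^sup>2) / 4) * (\<Sum>n = 1..N. ?D n)
          \<le> ereal ((1 - \<alpha>\<^sup>2) / 4) * ereal (4 / (1 - \<alpha>\<^sup>2) * (\<Sum>n = 1..N. ?R n))"
        using c by (intro ereal_mult_left_mono) auto
      also have "\<dots> = ereal (\<Sum>n = 1..N. ?R n)" using c by simp
      also have "(\<Sum>n = 1..N. ?R n) = (1 - \<alpha>) / 2 * (\<Sum>n = 1..N. ?x n)
          + (1 + \<alpha>) / 2 * (\<Sum>n = 1..N. ?y n) - (\<Sum>n = 1..N. ?z n) + (\<Sum>n = 1..N. \<delta> n)"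
        by (simp only: sum.distrib sum_subtractf sum_distrib_left)
      also have "ereal \<dots> \<le> ereal ((1 - \<alpha>) / 2 * (\<Sum>n = 1..N. ?x n)
          + (1 + \<alpha>) / 2 * (\<Sum>n = 1..N. ?y n) - (\<Sum>n = 1..N. ?z n) + \<epsilon>)"
        using sum_halves_le[of \<epsilon> N] assms(4) by (simp add: \<delta>_def)
      finally show ?thesis by (simp add: L1 L2 LS)
    qed
  qed
  with legal show ?thesis unfolding sceptic_can_guarantee_def by blast
qed

end
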